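(* Let $X$ be a complete metric space and let $U:\{(t,s)\in\mathbb{R}^2:t\ge s\}\times X\to X$ be a continuous process which possesses a pullback attractor $\mathcal{A}=\{\mathcal{A}(t)\}_{t\in\mathbb{R}}$. Assume that $U$ is forward asymptotically compact. Let $$\mathcal{A}_{\min}=\overline{\bigcup_{B\subset X\text{ bounded}}\ \bigcup_{t_0\in\mathbb{R}}\omega_f(B,t_0)}.$$ Then the condition $$\omega_f(B,t_0)\subset\omega_0(\mathcal{A})\quad\text{for any bounded set }B\subset X\text{ and any }t_0\in\mathbb{R}$$ is satisfied if and only if $dist(\mathcal{A}_{\min},\mathcal{A}(t))\to0$ as $t\to+\infty$.
   Context: Let $\rho$ be the metric of $X$. For $A,B\subset X$, $dist(A,B)=\sup_{y\in A}\inf_{x\in B}\rho(y,x)$ is the Hausdorff semidistance, and $dist(y,B)=dist(\{y\},B)$. A continuous process satisfies: $U(s,s,x)=x$; $U(t,s,x)=U(t,\tau,U(\tau,s,x))$ for $s\le\tau\le t$; and $(t,s,x)\mapsto U(t,s,x)$ is continuous. Write $U(t,s,B)=\{U(t,s,x):x\in B\}$. A family $\{K(t)\}_{t\in\mathbb{R}}$ of subsets of $X$ is invariant if $K(t)=U(t,s,K(s))$ for all $t\ge s$. A family of non-empty sets $\mathcal{A}=\{\mathcal{A}(t)\}$ is pullback attracting if for every bounded $B\subset X$ and every fixed $t$, $dist(U(t,t_0,B),\mathcal{A}(t))\to0$ as $t_0\to-\infty$. A pullback attractor is a family of non-empty compact invariant sets that is the minimal pullback attracting family of closed sets (i.e.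 it is pullback attracting, and if $\mathcal{C}=\{\mathcal{C}(t)\}$ is a pullback attracting family of closed sets then $\mathcal{A}(t)\subset\mathcal{C}(t)$ for all $t$). $U$ is forward asymptotically compact if for every $t_0\in\mathbb{R}$, every bounded $B\subset X$ and all $t_n\to+\infty$, every sequence $y_n\in U(t_n,t_0,B)$ has a converging subsequence. $\omega_f(B,t_0)=\{y:y=\lim_{n\to\infty}y_n,\ y_n\in U(t_n,t_0,B),\ t_n\to+\infty\}$ and $\omega_0(\mathcal{A})=\{y\in X:\lim_{t\to+\infty}dist(y,\mathcal{A}(t))=0\}$. *)

theory Defs
  imports "HOL-Analysis.Analysis"
begin

text \<open>
  The semidistance takes values in \<open>[0, \<infinity>]\<close>, since neither set is assumed bounded. In this complete
  lattice the supremum over the empty set is \<open>0\<close> and the infimum over the empty set is \<open>\<infinity>\<close>.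
\<close>

definition semidist :: "'a::metric_space set \<Rightarrow> 'a set \<Rightarrow> ennreal" where
  "semidist A B = (SUP y\<in>A. INF x\<in>B. ennreal (dist y x))"

text \<open>
  A process is a total function \<open>U t s x\<close>, of which only the values with \<open>s \<le> t\<close> are meaningful.
  All definitions below refer to these values only; in particular, sequences of times
  tending to \<open>+\<infinity>\<close> are required to stay above the initial time.
\<close>

definition continuous_process :: "(real \<Rightarrow> real \<Rightarrow> 'a::metric_space \<Rightarrow> 'a) \<Rightarrow> bool" where
  "continuous_process U \<longleftrightarrow>
     (\<forall>s x. U s s x = x) \<and>
     (\<forall>s \<tau> t x. s \<le> \<tau> \<longrightarrow> \<tau> \<le> t \<longrightarrow> U t s x = U t \<tau> (U \<tau> s x)) \<and>
     continuous_on {(t, s, x). s \<le> t} (\<lambda>(t, s, x). U t s x)"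

definition invariant_family :: "(real \<Rightarrow> real \<Rightarrow> 'a \<Rightarrow> 'a) \<Rightarrow> (real \<Rightarrow> 'a set) \<Rightarrow> bool" where
  "invariant_family U K \<longleftrightarrow> (\<forall>t s. s \<le> t \<longrightarrow> K t = U t s ` K s)"

definition pullback_attracting ::
    "(real \<Rightarrow> real \<Rightarrow> 'a::metric_space \<Rightarrow> 'a) \<Rightarrow> (real \<Rightarrow> 'a set) \<Rightarrow> bool" where
  "pullback_attracting U A \<longleftrightarrow>
     (\<forall>t. A t \<noteq> {}) \<and>
     (\<forall>B t. bounded B \<longrightarrow> ((\<lambda>t0. semidist (U t t0 ` B) (A t)) \<longlongrightarrow> 0) at_bot)"

definition pullback_attractor ::
    "(real \<Rightarrow> real \<Rightarrow> 'a::metric_space \<Rightarrow> 'a) \<Rightarrow> (real \<Rightarrow> 'a set) \<Rightarrow> bool" where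
  "pullback_attractor U A \<longleftrightarrow>
     (\<forall>t. A t \<noteq> {} \<and> compact (A t)) \<and>
     invariant_family U A \<and>
     pullback_attracting U A \<and>
     (\<forall>C. (\<forall>t. closed (C t)) \<longrightarrow> pullback_attracting U C \<longrightarrow> (\<forall>t. A t \<subseteq> C t))"

definition forward_asymptotically_compact ::
    "(real \<Rightarrow> real \<Rightarrow> 'a::metric_space \<Rightarrow> 'a) \<Rightarrow> bool" where
  "forward_asymptotically_compact U \<longleftrightarrow>
     (\<forall>t0 B (t :: nat \<Rightarrow> real) y.
        bounded B \<longrightarrow> (\<forall>n. t0 \<le> t n) \<longrightarrow> filterlim t at_top sequentially \<longrightarrow>
        (\<forall>n. y n \<in> U (t n) t0 ` B) \<longrightarrow>
        (\<exists>l r. strict_mono (r :: nat \<Rightarrow> nat) \<and> (y \<circ> r) \<longlonglongrightarrow> l))"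

definition omega_f ::
    "(real \<Rightarrow> real \<Rightarrow> 'a::metric_space \<Rightarrow> 'a) \<Rightarrow> 'a set \<Rightarrow> real \<Rightarrow> 'a set" where
  "omega_f U B t0 =
     {y. \<exists>(t :: nat \<Rightarrow> real) z.
        (\<forall>n. t0 \<le> t n) \<and> filterlim t at_top sequentially \<and>
        (\<forall>n. z n \<in> U (t n) t0 ` B) \<and> z \<longlonglongrightarrow> y}"

definition omega_0 :: "(real \<Rightarrow> 'a::metric_space set) \<Rightarrow> 'a set" where
  "omega_0 A = {y. ((\<lambda>t. semidist {y} (A t)) \<longlongrightarrow> 0) at_top}"

definition A_min :: "(real \<Rightarrow> real \<Rightarrow> 'a::metric_space \<Rightarrow> 'a) \<Rightarrow> 'a set" where
  "A_min U = closure (\<Union>B\<in>{B. bounded B}. \<Union>t0. omega_f U B t0)"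

end

theory Submission
  imports Defs
begin

text \<open>
  Invariance gives \<open>A t = U t 0 ` A 0\<close>, so \<open>\<omega>\<^sub>0(A)\<close> is contained in \<open>\<omega>\<^sub>f(A 0, 0)\<close>, which is
  compact by forward asymptotic compactness. If all \<open>\<omega>\<^sub>f(B, t\<^sub>0)\<close> lie in \<open>\<omega>\<^sub>0(A)\<close>, then \<open>A\<^sub>m\<^sub>i\<^sub>n\<close> is
  compact, and the pointwise convergence on its dense subset is uniform, because
  \<open>y \<mapsto> dist(y, A t)\<close> is 1-Lipschitz for every \<open>t\<close>.
\<close>

text \<open>Since \<open>0\<close> is the bottom of \<open>ennreal\<close>, only upper bounds
  matter, and by density every positive bound, even an infinite one, exceeds a positive real. All
  later estimates can thus use real \<open>e\<close>.\<close>

lemma tendsto_0_ennreal_iff: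
  fixes f :: "'b \<Rightarrow> ennreal"
  shows "(f \<longlongrightarrow> 0) F \<longleftrightarrow> (\<forall>e>0. \<forall>\<^sub>F x in F. f x < ennreal e)"
proof
  assume "(f \<longlongrightarrow> 0) F"
  then show "\<forall>e>0. \<forall>\<^sub>F x in F. f x < ennreal e"
    by (auto intro: order_tendstoD)
next
  assume *: "\<forall>e>0. \<forall>\<^sub>F x in F. f x < ennreal e"
  show "(f \<longlongrightarrow> 0) F"
  proof (rule order_tendstoI)
    fix a :: ennreal
    assume "0 < a"
    then obtain b where "0 < b" "b < a"
      using dense by blast
    then obtain e where "b = ennreal e" "0 < e"
      by (cases b) auto
    with * \<open>b < a\<close> show "\<forall>\<^sub>F x in F. f x < a"
      by (metis (mono_tags, lifting) eventually_mono order_less_trans)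
  qed auto
qed

lemma semidist_singleton: "semidist {y} B = (INF x\<in>B. ennreal (dist y x))"
  by (simp add: semidist_def)

lemma semidist_eq_SUP: "semidist A B = (SUP y\<in>A. semidist {y} B)"
  by (simp add: semidist_def)

lemma semidist_mono: "A \<subseteq> A' \<Longrightarrow> semidist A B \<le> semidist A' B"
  unfolding semidist_def by (rule SUP_subset_mono) auto

text \<open>The infimum need not be attained, but a strict bound on it yields a witness. For empty
  \<open>B\<close> the infimum is infinite and both sides fail.\<close>

lemma semidist_singleton_less_iff:
  assumes "0 < e"
  shows "semidist {y} B < ennreal e \<longleftrightarrow> (\<exists>x\<in>B. dist y x < e)"
  using assms by (simp add: semidist_singleton INF_less_iff ennreal_less_iff)

text \<open>Compactness reduces uniform convergence to finitely many pointwise ones: a finite net in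
  \<open>S\<close> is eventually close to \<open>A t\<close> at all its points
  simultaneously.\<close>

lemma semidist_closure_tendsto_0:
  fixes A :: "'b \<Rightarrow> 'a::metric_space set"
  assumes compact: "compact (closure S)"
    and pointwise: "\<And>y. y \<in> S \<Longrightarrow> ((\<lambda>t. semidist {y} (A t)) \<longlongrightarrow> 0) F"
  shows "((\<lambda>t. semidist (closure S) (A t)) \<longlongrightarrow> 0) F"
  unfolding tendsto_0_ennreal_iff
proof (intro allI impI)
  fix e :: real
  assume "0 < e"
  \<comment> \<open>One \<open>d\<close> is spent on reaching the net and one on reaching
    \<open>A t\<close>. The third restores strictness, which the supremum weakens to \<le>.\<close>
  define d where "d = e / 3"
  have "0 < d" using \<open>0 < e\<close> by (simp add: d_def)
  \<comment> \<open>The centres must lie in \<open>S\<close> itself, where pointwise convergence is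
    known.\<close>
  have "closure S \<subseteq> (\<Union>y\<in>S. ball y d)"
    using \<open>0 < d\<close> by (auto simp: closure_approachable)
  then obtain N where N: "N \<subseteq> S" "finite N" "closure S \<subseteq> (\<Union>y\<in>N. ball y d)"
    using compactE_image[OF compact, of S "\<lambda>y. ball y d"] by auto
  have "\<forall>\<^sub>F t in F. semidist {y} (A t) < ennreal d" if "y \<in> N" for y
    using pointwise[of y] that N(1) \<open>0 < d\<close> unfolding tendsto_0_ennreal_iff by blast
  then have "\<forall>\<^sub>F t in F. \<forall>y\<in>N. semidist {y} (A t) < ennreal d"
    using N(2) by (simp add: eventually_ball_finite)
  then show "\<forall>\<^sub>F t in F. semidist (closure S) (A t) < ennreal e"
  proof eventually_elim
    case (elim t)
    have "semidist {x} (A t) \<le> ennreal (2 * d)" if x: "x \<in> closure S" for x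
    proof -
      obtain y where y: "y \<in> N" "dist y x < d"
        using subsetD[OF N(3) x] by auto
      then obtain z where "z \<in> A t" "dist y z < d"
        using elim \<open>0 < d\<close> by (auto simp: semidist_singleton_less_iff)
      moreover have "dist x z \<le> dist y x + dist y z"
        by (rule dist_triangle3)
      ultimately have "\<exists>z\<in>A t. dist x z < 2 * d"
        using y(2) by force
      then show ?thesis
        using \<open>0 < d\<close> by (simp add: less_imp_le semidist_singleton_less_iff)
    qed
    then have "semidist (closure S) (A t) \<le> ennreal (2 * d)"
      unfolding semidist_eq_SUP[of "closure S"] by (rule SUP_least)
    also have "\<dots> < ennreal e"
      using \<open>0 < e\<close> by (simp add: d_def ennreal_less_iff)
    finally show ?case .
  qed
qed

text \<open>This sequence-free form makes \<epsilon>/2 arguments direct. Conversely, sequences arise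
  from the choices \<open>T = n\<close> and \<open>e = 1/(n+1)\<close>.\<close>

lemma mem_omega_f_iff:
  "y \<in> omega_f U B t0 \<longleftrightarrow>
     (\<forall>e>0. \<forall>T. \<exists>t\<ge>t0. T \<le> t \<and> (\<exists>z\<in>U t t0 ` B. dist z y < e))"
proof
  assume "y \<in> omega_f U B t0"
  then obtain t z where tz: "\<And>n. t0 \<le> t n" "filterlim t at_top sequentially"
      "\<And>n::nat. z n \<in> U (t n) t0 ` B" "z \<longlonglongrightarrow> y"
    unfolding omega_f_def by blast
  show "\<forall>e>0. \<forall>T. \<exists>t\<ge>t0. T \<le> t \<and> (\<exists>z\<in>U t t0 ` B. dist z y < e)"
  proof (intro allI impI)
    fix e T :: real
    assume "0 < e"
    then have "\<forall>\<^sub>F n in sequentially. T \<le> t n \<and> dist (z n) y < e"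
      using tz(2) tendstoD[OF tz(4)] by (auto simp: filterlim_at_top eventually_conj_iff)
    then obtain n where "T \<le> t n" "dist (z n) y < e"
      by (auto simp: eventually_sequentially)
    then show "\<exists>t\<ge>t0. T \<le> t \<and> (\<exists>z\<in>U t t0 ` B. dist z y < e)"
      using tz(1,3) by blast
  qed
next
  assume "\<forall>e>0. \<forall>T. \<exists>t\<ge>t0. T \<le> t \<and> (\<exists>z\<in>U t t0 ` B. dist z y < e)"
  then have "\<forall>n. \<exists>t z. t0 \<le> t \<and> real n \<le> t \<and> z \<in> U t t0 ` B \<and> dist z y < inverse (real (Suc n))"
    by (metis inverse_positive_iff_positive of_nat_0_less_iff zero_less_Suc)
  then obtain t z where tz: "\<And>n. t0 \<le> t n" "\<And>n. real n \<le> t n"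
      "\<And>n. z n \<in> U (t n) t0 ` B" "\<And>n. dist (z n) y < inverse (real (Suc n))"
    by metis
  have "filterlim t at_top sequentially"
    using filterlim_real_sequentially by (rule filterlim_at_top_mono) (simp add: tz(2))
  moreover have "z \<longlonglongrightarrow> y"
    unfolding tendsto_dist_iff[of z]
    by (rule tendsto_sandwich[OF _ _ tendsto_const LIMSEQ_inverse_real_of_nat])
      (auto intro: always_eventually less_imp_le tz(4) simp del: of_nat_Suc)
  ultimately show "y \<in> omega_f U B t0"
    unfolding omega_f_def using tz(1,3) by blast
qed

text \<open>The criterion \<open>mem_omega_f_iff\<close> survives limits: half of \<open>e\<close>
  goes to a nearby limit point, half to a trajectory point near it.\<close>

lemma closed_omega_f: "closed (omega_f U B t0)"
  unfolding closure_subset_eq[symmetric]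
proof
  fix x
  assume "x \<in> closure (omega_f U B t0)"
  then have *: "\<forall>e>0. \<exists>y\<in>omega_f U B t0. dist y x < e"
    by (simp add: closure_approachable)
  show "x \<in> omega_f U B t0"
    unfolding mem_omega_f_iff
  proof (intro allI impI)
    fix e T :: real
    assume "0 < e"
    then obtain y where y: "y \<in> omega_f U B t0" "dist y x < e / 2"
      using * by (meson half_gt_zero)
    from y(1) \<open>0 < e\<close> obtain t z where "t0 \<le> t" "T \<le> t" "z \<in> U t t0 ` B" "dist z y < e / 2"
      unfolding mem_omega_f_iff by (meson half_gt_zero)
    then show "\<exists>t\<ge>t0. T \<le> t \<and> (\<exists>z\<in>U t t0 ` B. dist z x < e)"
      using y(2) dist_triangle_half_r[of y z e x] by (metis dist_commute)
  qed
qed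

text \<open>Shadow each \<open>y n\<close> by a trajectory point \<open>z n\<close> at a time beyond
  \<open>n\<close>. Asymptotic compactness makes a subsequence of \<open>z\<close> converge,
  \<open>y\<close> follows along it, and closedness keeps the limit inside.\<close>

lemma compact_omega_f:
  assumes "forward_asymptotically_compact U" "bounded B"
  shows "compact (omega_f U B t0)"
  unfolding compact_def
proof (intro allI impI)
  fix y :: "nat \<Rightarrow> 'a"
  assume y: "\<forall>n. y n \<in> omega_f U B t0"
  then have "\<forall>n. \<exists>t z. t0 \<le> t \<and> real n \<le> t \<and> z \<in> U t t0 ` B \<and> dist z (y n) < inverse (real (Suc n))"
    unfolding mem_omega_f_iff
    by (metis inverse_positive_iff_positive of_nat_0_less_iff zero_less_Suc)
  then obtain t z where tz: "\<And>n. t0 \<le> t n" "\<And>n. real n \<le> t n"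
      "\<And>n. z n \<in> U (t n) t0 ` B" "\<And>n. dist (z n) (y n) < inverse (real (Suc n))"
    by metis
  have "filterlim t at_top sequentially"
    using filterlim_real_sequentially by (rule filterlim_at_top_mono) (simp add: tz(2))
  then obtain l and r :: "nat \<Rightarrow> nat" where r: "strict_mono r" "(z \<circ> r) \<longlonglongrightarrow> l"
    using assms tz(1,3) unfolding forward_asymptotically_compact_def by meson
  have "(\<lambda>n. dist (z n) (y n)) \<longlonglongrightarrow> 0"
    by (rule tendsto_sandwich[OF _ _ tendsto_const LIMSEQ_inverse_real_of_nat])
      (auto intro: always_eventually less_imp_le tz(4) simp del: of_nat_Suc)
  from LIMSEQ_subseq_LIMSEQ[OF this r(1)]
  have "(\<lambda>n. dist ((z \<circ> r) n) ((y \<circ> r) n)) \<longlonglongrightarrow> 0"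
    by (simp add: o_def)
  \<comment> \<open>By the triangle inequality this sum dominates the distance from
    \<open>(y \<circ> r) n\<close> to \<open>l\<close>.\<close>
  then have "(\<lambda>n. dist ((z \<circ> r) n) ((y \<circ> r) n) + dist ((z \<circ> r) n) l) \<longlonglongrightarrow> 0"
    using r(2) unfolding tendsto_dist_iff[of "z \<circ> r"] by (rule tendsto_add_zero)
  then have lim: "(y \<circ> r) \<longlonglongrightarrow> l"
    unfolding tendsto_dist_iff[of "y \<circ> r"]
    by (rule tendsto_sandwich[OF _ _ tendsto_const, rotated 2])
      (auto intro: always_eventually dist_triangle3)
  moreover have "l \<in> omega_f U B t0"
    using closed_omega_f _ lim by (rule closed_sequentially) (use y in simp)
  ultimately show "\<exists>l\<in>omega_f U B t0. \<exists>r. strict_mono r \<and> (y \<circ> r) \<longlonglongrightarrow> l"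
    using r(1) by blast
qed

lemma omega_0_subset_omega_f:
  assumes "invariant_family U A"
  shows "omega_0 A \<subseteq> omega_f U (A t0) t0"
proof
  fix y
  assume "y \<in> omega_0 A"
  then have lim: "((\<lambda>t. semidist {y} (A t)) \<longlongrightarrow> 0) at_top"
    by (simp add: omega_0_def)
  show "y \<in> omega_f U (A t0) t0"
    unfolding mem_omega_f_iff
  proof (intro allI impI)
    fix e T :: real
    assume "0 < e"
    with lim have "\<forall>\<^sub>F t in at_top. semidist {y} (A t) < ennreal e"
      unfolding tendsto_0_ennreal_iff by blast
    \<comment> \<open>Besides \<open>T \<le> t\<close>, the bound \<open>t0 \<le> t\<close> is
      required so that invariance turns points of \<open>A t\<close> into trajectory points started
      in \<open>A t0\<close>.\<close>
    then have "\<forall>\<^sub>F t in at_top. semidist {y} (A t) < ennreal e \<and> max t0 T \<le> t"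
      using eventually_ge_at_top by (rule eventually_conj)
    then obtain t where t: "semidist {y} (A t) < ennreal e" "max t0 T \<le> t"
      using eventually_happens by fastforce
    then have "A t = U t t0 ` A t0"
      using assms by (simp add: invariant_family_def)
    with t \<open>0 < e\<close> show "\<exists>t\<ge>t0. T \<le> t \<and> (\<exists>z\<in>U t t0 ` A t0. dist z y < e)"
      by (metis dist_commute max.bounded_iff semidist_singleton_less_iff)
  qed
qed

theorem lemma11:
  fixes U :: "real \<Rightarrow> real \<Rightarrow> 'a::complete_space \<Rightarrow> 'a"
    and A :: "real \<Rightarrow> 'a set"
  assumes "continuous_process U"
    and "pullback_attractor U A"
    and "forward_asymptotically_compact U"
  shows "(\<forall>B t0. bounded B \<longrightarrow> omega_f U B t0 \<subseteq> omega_0 A) \<longleftrightarrow>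
         ((\<lambda>t. semidist (A_min U) (A t)) \<longlongrightarrow> 0) at_top"
proof
  assume sub: "\<forall>B t0. bounded B \<longrightarrow> omega_f U B t0 \<subseteq> omega_0 A"
  define S where "S = (\<Union>B\<in>{B. bounded B}. \<Union>t0. omega_f U B t0)"
  have S: "S \<subseteq> omega_0 A"
    using sub by (auto simp: S_def)
  have "invariant_family U A" "bounded (A 0)"
    using assms(2) by (auto simp: pullback_attractor_def compact_imp_bounded)
  \<comment> \<open>A single compact set contains the limit sets for all \<open>B\<close> and
    \<open>t0\<close>; the initial time \<open>0\<close> is an arbitrary choice.\<close>
  then have "S \<subseteq> omega_f U (A 0) 0" "compact (omega_f U (A 0) 0)"
    using S omega_0_subset_omega_f compact_omega_f[OF assms(3)] by blast+
  then have "compact (closure S)"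
    by (metis closed_closure closed_omega_f closure_minimal compact_Int_closed inf.absorb2)
  then show "((\<lambda>t. semidist (A_min U) (A t)) \<longlongrightarrow> 0) at_top"
    unfolding A_min_def S_def[symmetric]
    by (rule semidist_closure_tendsto_0) (use S in \<open>auto simp: omega_0_def\<close>)
next
  assume lim: "((\<lambda>t. semidist (A_min U) (A t)) \<longlongrightarrow> 0) at_top"
  show "\<forall>B t0. bounded B \<longrightarrow> omega_f U B t0 \<subseteq> omega_0 A"
  proof (intro allI impI subsetI)
    fix B t0 y
    assume "bounded B" "y \<in> omega_f U B t0"
    then have "y \<in> A_min U"
      unfolding A_min_def by (intro subsetD[OF closure_subset]) blast
    \<comment> \<open>Monotonicity in the first argument squeezes the distance from \<open>y\<close>
      between \<open>0\<close> and a null function.\<close>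
    then have "semidist {y} (A t) \<le> semidist (A_min U) (A t)" for t
      by (intro semidist_mono) simp
    then show "y \<in> omega_0 A"
      unfolding omega_0_def mem_Collect_eq
      by (intro tendsto_sandwich[OF _ _ tendsto_const lim]) auto
  qed
qed

end
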